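(* Let $R$ be a commutative ring, $M$ an $R$-module, $Y\subseteq q\mathrm{Spec}(M)$, $I$ a quasi-prime ideal of $R$ and $L\in q\mathrm{Spec}_I(M)$. Equip $q\mathrm{Spec}(M)$ with the developed Zariski topology and let $\Im(Y)$ denote the intersection of all elements of $Y$. (1) $D(\Im(Y))=Cl(Y)$. In particular, $Cl(\{L\})=D(L)$. (2) Let $M$ be semiprimitive (resp. reduced) and let $\mathrm{Max}(M)$ (resp. $\mathrm{Spec}(M)$) be a non-empty connected subspace of $q\mathrm{Spec}(M)$. Then $q\mathrm{Spec}(M)$ is connected. (3) If $(\mathbf{0})\in Y$, then $Y$ is dense in $q\mathrm{Spec}(M)$. (4) The set $\{L\}$ is closed in $q\mathrm{Spec}(M)$ if and only if (a) $I$ is a maximal element of $\{(N:M)\mid N\in q\mathrm{Spec}(M)\}$, and (b) $q\mathrm{Spec}_I(M)=\{L\}$. (5) If $\{L\}$ is closed in $q\mathrm{Spec}(M)$, then $L$ is a maximal element of $q\mathrm{Spec}(M)$ and $q\mathrm{Spec}_I(M)=\{L\}$. (6) $M$ is quasi-prime-embedding if and only if $q\mathrm{Spec}(M)$ is a $T_0$-space. (7) $q\mathrm{Spec}(M)$ is a $T_1$-space if and only if $q\mathrm{Spec}(M)$ is a $T_0$-space and for every $L\in q\mathrm{Spec}(M)$, $(L:M)$ is a maximal element of $\{(N:M)\mid N\in q\mathrm{Spec}(M)\}$. (8) If $q\mathrm{Spec}(M)$ is a $T_1$-space, then $q\mathrm{Spec}(M)$ is a $T_0$-space and every quasi-prime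 submodule is a maximal element of $q\mathrm{Spec}(M)$. The converse is also true when $M$ is finitely generated. (9) Let $(\mathbf{0})\in q\mathrm{Spec}(M)$. Then $q\mathrm{Spec}(M)$ is a $T_1$-space if and only if $(\mathbf{0})$ is the only quasi-prime submodule of $M$.
   Context: All rings are commutative with nonzero identity and all modules are unital. For a submodule $N$ of $M$, $(N:M)=\{r\in R\mid rM\subseteq N\}$ and $\mathrm{Ann}(M)=(\mathbf 0:M)$. A proper ideal $I$ of a ring is quasi-prime if for all ideals $A,B$, $A\cap B\subseteq I$ implies $A\subseteq I$ or $B\subseteq I$. A proper submodule $N$ of $M$ is quasi-prime if $(N:M)$ is a quasi-prime ideal. $q\mathrm{Spec}(M)$ is the set of quasi-prime submodules of $M$, ordered by inclusion, and $q\mathrm{Spec}_I(M)=\{N\in q\mathrm{Spec}(M)\mid (N:M)=I\}$. For a submodule $N$ of $M$, $D(N)=D^M(N)=\{L\in q\mathrm{Spec}(M)\mid (L:M)\supseteq (N:M)\}$. The developed Zariski topology on $q\mathrm{Spec}(M)$ is the topology whose closed sets are exactly the sets $D(N)$, $N$ a submodule of $M$. $Cl(Y)$ is the closure of $Y$; the intersection of the empty family of submodules is $M$. $M$ is quasi-prime-embedding if the natural map $\psi: q\mathrm{Spec}(M)\to q\mathrm{Spec}(R/\mathrm{Ann}(M))$, $\psi(L)=(L:M)/\mathrm{Ann}(M)$, is injective. $\mathrm{Max}(M)$ is the set of maximal submodules of $M$. A submodule $P\neq M$ is prime if $rm\in P$ implies $r\in (P:M)$ or $m\in P$; $\mathrm{Spec}(M)$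 is the set of prime submodules. One has $\mathrm{Max}(M)\subseteq \mathrm{Spec}(M)\subseteq q\mathrm{Spec}(M)$. $M$ is semiprimitive (resp. reduced) if the intersection of all its maximal (resp. prime) submodules is zero. *)

theory Defs
  imports "HOL-Algebra.Module" "HOL-Algebra.QuotRing" "HOL-Analysis.Abstract_Topological_Spaces"
begin

definition colon ::
  "('r, 'k) ring_scheme \<Rightarrow> ('r, 'm, 's) module_scheme \<Rightarrow> 'm set \<Rightarrow> 'r set"
  where "colon R M N = {r \<in> carrier R. \<forall>m \<in> carrier M. r \<odot>\<^bsub>M\<^esub> m \<in> N}"

definition Ann :: "('r, 'k) ring_scheme \<Rightarrow> ('r, 'm, 's) module_scheme \<Rightarrow> 'r set"
  where "Ann R M = colon R M {\<zero>\<^bsub>M\<^esub>}"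

definition quasi_prime_ideal :: "('r, 'k) ring_scheme \<Rightarrow> 'r set \<Rightarrow> bool"
  where "quasi_prime_ideal R I \<longleftrightarrow>
    ideal I R \<and> I \<noteq> carrier R \<and>
    (\<forall>A B. ideal A R \<and> ideal B R \<and> A \<inter> B \<subseteq> I \<longrightarrow> A \<subseteq> I \<or> B \<subseteq> I)"

definition quasi_prime_submodule ::
  "('r, 'k) ring_scheme \<Rightarrow> ('r, 'm, 's) module_scheme \<Rightarrow> 'm set \<Rightarrow> bool"
  where "quasi_prime_submodule R M N \<longleftrightarrow>
    submodule N R M \<and> N \<noteq> carrier M \<and> quasi_prime_ideal R (colon R M N)"

definition qSpec :: "('r, 'k) ring_scheme \<Rightarrow> ('r, 'm, 's) module_scheme \<Rightarrow> 'm set set"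
  where "qSpec R M = {N. quasi_prime_submodule R M N}"

definition qSpec_at ::
  "('r, 'k) ring_scheme \<Rightarrow> ('r, 'm, 's) module_scheme \<Rightarrow> 'r set \<Rightarrow> 'm set set"
  where "qSpec_at R M I = {N \<in> qSpec R M. colon R M N = I}"

definition qSpec_ring :: "('r, 'k) ring_scheme \<Rightarrow> 'r set set"
  where "qSpec_ring R = {I. quasi_prime_ideal R I}"

definition qD ::
  "('r, 'k) ring_scheme \<Rightarrow> ('r, 'm, 's) module_scheme \<Rightarrow> 'm set \<Rightarrow> 'm set set"
  where "qD R M N = {L \<in> qSpec R M. colon R M N \<subseteq> colon R M L}"

text \<open>Intersecting with the carrier makes the intersection of the empty family equal to \<open>M\<close>.\<close>

definition submodule_Inter :: "('r, 'm, 's) module_scheme \<Rightarrow> 'm set set \<Rightarrow> 'm set"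
  where "submodule_Inter M Y = carrier M \<inter> \<Inter>Y"

text \<open>
  The open sets are the complements of the sets \<open>D(N)\<close>.  That this family is a topology,
  so that \<open>topology\<close> is applied to it meaningfully, is \<open>istopology_zariski\<close> below.
\<close>

definition zariski ::
  "('r, 'k) ring_scheme \<Rightarrow> ('r, 'm, 's) module_scheme \<Rightarrow> 'm set topology"
  where "zariski R M = topology (\<lambda>U. \<exists>N. submodule N R M \<and> U = qSpec R M - qD R M N)"

definition is_maximal_in :: "'a set \<Rightarrow> 'a set set \<Rightarrow> bool"
  where "is_maximal_in X S \<longleftrightarrow> X \<in> S \<and> (\<forall>Z \<in> S. X \<subseteq> Z \<longrightarrow> Z = X)"

definition colon_values ::
  "('r, 'k) ring_scheme \<Rightarrow> ('r, 'm, 's) module_scheme \<Rightarrow> 'r set set"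
  where "colon_values R M = {colon R M N | N. N \<in> qSpec R M}"

definition Max_submodules ::
  "('r, 'k) ring_scheme \<Rightarrow> ('r, 'm, 's) module_scheme \<Rightarrow> 'm set set"
  where "Max_submodules R M = {N. is_maximal_in N {K. submodule K R M \<and> K \<noteq> carrier M}}"

definition prime_submodule ::
  "('r, 'k) ring_scheme \<Rightarrow> ('r, 'm, 's) module_scheme \<Rightarrow> 'm set \<Rightarrow> bool"
  where "prime_submodule R M P \<longleftrightarrow>
    submodule P R M \<and> P \<noteq> carrier M \<and>
    (\<forall>r \<in> carrier R. \<forall>m \<in> carrier M. r \<odot>\<^bsub>M\<^esub> m \<in> P \<longrightarrow> r \<in> colon R M P \<or> m \<in> P)"

definition Spec :: "('r, 'k) ring_scheme \<Rightarrow> ('r, 'm, 's) module_scheme \<Rightarrow> 'm set set"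
  where "Spec R M = {P. prime_submodule R M P}"

definition semiprimitive_module :: "('r, 'k) ring_scheme \<Rightarrow> ('r, 'm, 's) module_scheme \<Rightarrow> bool"
  where "semiprimitive_module R M \<longleftrightarrow> submodule_Inter M (Max_submodules R M) = {\<zero>\<^bsub>M\<^esub>}"

definition reduced_module :: "('r, 'k) ring_scheme \<Rightarrow> ('r, 'm, 's) module_scheme \<Rightarrow> bool"
  where "reduced_module R M \<longleftrightarrow> submodule_Inter M (Spec R M) = {\<zero>\<^bsub>M\<^esub>}"

definition finitely_generated_module ::
  "('r, 'k) ring_scheme \<Rightarrow> ('r, 'm, 's) module_scheme \<Rightarrow> bool"
  where "finitely_generated_module R M \<longleftrightarrow>
    (\<exists>S. finite S \<and> S \<subseteq> carrier M \<and> \<Inter>{N. submodule N R M \<and> S \<subseteq> N} = carrier M)"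

text \<open>
  The ideal \<open>(L:M)/Ann(M)\<close> of \<open>R/Ann(M)\<close> is the set of the cosets of \<open>Ann(M)\<close> that are
  represented by elements of \<open>(L:M)\<close>.  That \<open>\<psi>\<close> maps \<open>qSpec(M)\<close> into \<open>qSpec(R/Ann(M))\<close> is
  \<open>natural_map_in_qSpec_ring\<close> below.
\<close>

definition natural_map ::
  "('r, 'k) ring_scheme \<Rightarrow> ('r, 'm, 's) module_scheme \<Rightarrow> 'm set \<Rightarrow> 'r set set"
  where "natural_map R M L = (\<lambda>r. Ann R M +>\<^bsub>R\<^esub> r) ` colon R M L"

definition quasi_prime_embedding ::
  "('r, 'k) ring_scheme \<Rightarrow> ('r, 'm, 's) module_scheme \<Rightarrow> bool"
  where "quasi_prime_embedding R M \<longleftrightarrow> inj_on (natural_map R M) (qSpec R M)"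

context Module.module
begin

lemma ideal_colon:
  assumes N: "submodule N R M"
  shows "ideal (colon R M N) R"
proof (rule idealI)
  note E = submoduleE[OF N]
  have z: "\<zero>\<^bsub>M\<^esub> \<in> N"
    using N subgroup.one_closed[OF submodule.axioms(1)[OF N]] by simp
  show "ring R" ..
  show "subgroup (colon R M N) (add_monoid R)"
  proof (rule R.add.subgroupI)
    show "colon R M N \<noteq> {}" using z unfolding colon_def by force
  next
    fix a assume "a \<in> colon R M N"
    then show "\<ominus> a \<in> colon R M N"
      using E(3) by (auto simp: colon_def smult_l_minus)
  next
    fix a b assume "a \<in> colon R M N" "b \<in> colon R M N"
    then show "a \<oplus> b \<in> colon R M N"
      using E(5) by (auto simp: colon_def smult_l_distr)
  qed (auto simp: colon_def)
next
  fix a x assume a: "a \<in> colon R M N" and x: "x \<in> carrier R"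
  then show xa: "x \<otimes> a \<in> colon R M N"
    using submoduleE(4)[OF N] by (auto simp: colon_def smult_assoc1)
  have "a \<otimes> x = x \<otimes> a" using a x by (auto simp: colon_def R.m_comm)
  with xa show "a \<otimes> x \<in> colon R M N" by simp
qed

lemma submodule_Inter_family:
  assumes "\<And>N. N \<in> F \<Longrightarrow> submodule N R M" "F \<noteq> {}"
  shows "submodule (\<Inter>F) R M"
proof (rule submoduleI)
  show "\<Inter>F \<subseteq> carrier M" using assms submoduleE(1) by blast
  show "\<zero>\<^bsub>M\<^esub> \<in> \<Inter>F"
    using assms subgroup.one_closed[OF submodule.axioms(1)] by fastforce
qed (use assms submoduleE(3-5) in blast)+

lemma istopology_zariski:
  "istopology (\<lambda>U. \<exists>N. submodule N R M \<and> U = qSpec R M - qD R M N)"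
  unfolding istopology_def
proof (intro conjI allI impI)
  fix S T
  assume "\<exists>N. submodule N R M \<and> S = qSpec R M - qD R M N"
    and "\<exists>N. submodule N R M \<and> T = qSpec R M - qD R M N"
  then obtain A B where A: "submodule A R M" "S = qSpec R M - qD R M A"
    and B: "submodule B R M" "T = qSpec R M - qD R M B" by blast
  have sub: "submodule (A \<inter> B) R M"
    using submodule_Inter_family[of "{A, B}"] A B by auto
  have int: "colon R M (A \<inter> B) = colon R M A \<inter> colon R M B"
    by (auto simp: colon_def)
  have "qD R M (A \<inter> B) = qD R M A \<union> qD R M B"
    using ideal_colon[OF A(1)] ideal_colon[OF B(1)]
    unfolding qD_def int
    by (auto simp: qSpec_def quasi_prime_submodule_def quasi_prime_ideal_def)
  with sub show "\<exists>N. submodule N R M \<and> S \<inter> T = qSpec R M - qD R M N"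
    using A B by blast
next
  fix K
  assume K: "\<forall>U\<in>K. \<exists>N. submodule N R M \<and> U = qSpec R M - qD R M N"
  define F where "F = {N. submodule N R M \<and> qSpec R M - qD R M N \<in> K}"
  define G where "G = {L. submodule L R M \<and> (\<forall>N\<in>F. colon R M N \<subseteq> colon R M L)}"
  have cG: "carrier M \<in> G"
    unfolding G_def using carrier_is_submodule by (auto simp: colon_def)
  then have sub: "submodule (\<Inter>G) R M"
    by (intro submodule_Inter_family) (auto simp: G_def)
  have "L \<in> qD R M (\<Inter>G) \<longleftrightarrow> L \<in> qSpec R M \<and> (\<forall>N\<in>F. L \<in> qD R M N)" for L
  proof
    assume "L \<in> qD R M (\<Inter>G)"
    moreover have "colon R M N \<subseteq> colon R M (\<Inter>G)" if "N \<in> F" for N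
      using that cG unfolding G_def colon_def by blast
    ultimately show "L \<in> qSpec R M \<and> (\<forall>N\<in>F. L \<in> qD R M N)"
      by (auto simp: qD_def)
  next
    assume L: "L \<in> qSpec R M \<and> (\<forall>N\<in>F. L \<in> qD R M N)"
    then have "L \<in> G"
      by (auto simp: G_def qD_def qSpec_def quasi_prime_submodule_def)
    then have "colon R M (\<Inter>G) \<subseteq> colon R M L" unfolding colon_def by blast
    with L show "L \<in> qD R M (\<Inter>G)" by (simp add: qD_def)
  qed
  moreover have "\<Union>K = (\<Union>N\<in>F. qSpec R M - qD R M N)"
  proof (intro equalityI subsetI)
    fix L assume "L \<in> \<Union>K"
    then obtain U where U: "U \<in> K" "L \<in> U" by (rule UnionE)
    from K U(1) obtain N where "submodule N R M" "U = qSpec R M - qD R M N" by auto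
    then show "L \<in> (\<Union>N\<in>F. qSpec R M - qD R M N)"
      using U by (intro UN_I[of N]) (simp_all add: F_def)
  next
    fix L assume "L \<in> (\<Union>N\<in>F. qSpec R M - qD R M N)"
    then show "L \<in> \<Union>K" unfolding F_def by auto
  qed
  ultimately have "\<Union>K = qSpec R M - qD R M (\<Inter>G)" by auto
  with sub show "\<exists>N. submodule N R M \<and> \<Union>K = qSpec R M - qD R M N" by blast
qed

lemma openin_zariski:
  "openin (zariski R M) U \<longleftrightarrow> (\<exists>N. submodule N R M \<and> U = qSpec R M - qD R M N)"
  unfolding zariski_def by (simp add: topology_inverse'[OF istopology_zariski])

lemma topspace_zariski: "topspace (zariski R M) = qSpec R M"
proof -
  have "\<one> \<notin> colon R M L" if "L \<in> qSpec R M" for L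
  proof
    assume "\<one> \<in> colon R M L"
    then have "colon R M L = carrier R"
      using that ideal.one_imp_carrier
      by (auto simp: qSpec_def quasi_prime_submodule_def quasi_prime_ideal_def)
    with that show False
      by (auto simp: qSpec_def quasi_prime_submodule_def quasi_prime_ideal_def)
  qed
  moreover have "\<one> \<in> colon R M (carrier M)" by (simp add: colon_def)
  ultimately have "qD R M (carrier M) = {}"
    unfolding qD_def by blast
  then have "openin (zariski R M) (qSpec R M)"
    using carrier_is_submodule unfolding openin_zariski by blast
  then have "qSpec R M \<subseteq> topspace (zariski R M)" by (rule openin_subset)
  moreover have "topspace (zariski R M) \<subseteq> qSpec R M"
    using openin_topspace[of "zariski R M"] unfolding openin_zariski by auto
  ultimately show ?thesis by (rule equalityI[rotated])
qed

lemma closedin_zariski: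
  "closedin (zariski R M) C \<longleftrightarrow> (\<exists>N. submodule N R M \<and> C = qD R M N)"
proof -
  have sub: "qD R M N \<subseteq> qSpec R M" for N by (auto simp: qD_def)
  have "qSpec R M - C = qSpec R M - qD R M N \<longleftrightarrow> C = qD R M N" if "C \<subseteq> qSpec R M" for N
    using that sub[of N] by blast
  then show ?thesis
    unfolding closedin_def topspace_zariski openin_zariski using sub by blast
qed

lemma natural_map_in_qSpec_ring:
  assumes L: "L \<in> qSpec R M"
  shows "natural_map R M L \<in> qSpec_ring (R Quot Ann R M)"
proof -
  let ?I = "colon R M L" and ?A = "Ann R M" and ?\<pi> = "\<lambda>r. Ann R M +> r"
  have Lsub: "submodule L R M" and qp: "quasi_prime_ideal R ?I"
    using L by (auto simp: qSpec_def quasi_prime_submodule_def)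
  then have I: "ideal ?I R" "?I \<noteq> carrier R" by (auto simp: quasi_prime_ideal_def)
  have zsub: "submodule {\<zero>\<^bsub>M\<^esub>} R M" by (rule submoduleI) auto
  have A: "ideal ?A R" unfolding Ann_def by (rule ideal_colon[OF zsub])
  have zL: "\<zero>\<^bsub>M\<^esub> \<in> L"
    using subgroup.one_closed[OF submodule.axioms(1)[OF Lsub]] by simp
  have AI: "?A \<subseteq> ?I" using zL by (auto simp: Ann_def colon_def)
  have hom: "ring_hom_ring R (R Quot ?A) ?\<pi>" by (rule ideal.rcos_ring_hom_ring[OF A])
  have surj: "?\<pi> ` carrier R = carrier (R Quot ?A)"
    by (auto simp: FactRing_def A_RCOSETS_def')
  have sat: "r \<in> ?I" if r: "r \<in> carrier R" and mem: "?\<pi> r \<in> ?\<pi> ` ?I" for r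
  proof -
    obtain s where s: "s \<in> ?I" "?\<pi> r = ?\<pi> s" using mem by blast
    then have sc: "s \<in> carrier R" by (auto simp: colon_def)
    have "r \<in> ?\<pi> r"
      by (rule abelian_subgroup.a_rcos_self[OF abelian_subgroupI3[OF ideal.axioms(1)[OF A] R.is_abelian_group] r])
    then have "r \<in> ?\<pi> s" using s by simp
    then obtain a where "a \<in> ?A" "r = a \<oplus> s" by (auto simp: a_r_coset_def')
    then show ?thesis
      using AI s additive_subgroup.a_closed[OF ideal.axioms(1)[OF I(1)]] by blast
  qed
  have id: "ideal (?\<pi> ` ?I) (R Quot ?A)"
    by (rule R.ring_ideal_imp_quot_ideal[OF A I(1)])
  have ne: "?\<pi> ` ?I \<noteq> carrier (R Quot ?A)"
  proof
    assume eq: "?\<pi> ` ?I = carrier (R Quot ?A)"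
    have "r \<in> ?I" if r: "r \<in> carrier R" for r
    proof (rule sat[OF r])
      show "?\<pi> r \<in> ?\<pi> ` ?I" unfolding eq surj[symmetric] using r by (rule imageI)
    qed
    moreover have "?I \<subseteq> carrier R" by (auto simp: colon_def)
    ultimately show False using I(2) by blast
  qed
  have "X \<subseteq> ?\<pi> ` ?I \<or> Y \<subseteq> ?\<pi> ` ?I"
    if X: "ideal X (R Quot ?A)" and Y: "ideal Y (R Quot ?A)" and XY: "X \<inter> Y \<subseteq> ?\<pi> ` ?I" for X Y
  proof -
    let ?X = "{r \<in> carrier R. ?\<pi> r \<in> X}" and ?Y = "{r \<in> carrier R. ?\<pi> r \<in> Y}"
    have "ideal ?X R" "ideal ?Y R"
      by (rule ring_hom_ring.ideal_vimage[OF hom X], rule ring_hom_ring.ideal_vimage[OF hom Y])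
    moreover have "?X \<inter> ?Y \<subseteq> ?I"
    proof
      fix r assume "r \<in> ?X \<inter> ?Y"
      then have "r \<in> carrier R" "?\<pi> r \<in> X \<inter> Y" by simp_all
      then show "r \<in> ?I" using XY sat[of r] by (meson subsetD)
    qed
    ultimately have "?X \<subseteq> ?I \<or> ?Y \<subseteq> ?I"
      using qp unfolding quasi_prime_ideal_def by blast
    moreover have "Z \<subseteq> ?\<pi> ` ?I"
      if Z: "ideal Z (R Quot ?A)" and sub: "{r \<in> carrier R. ?\<pi> r \<in> Z} \<subseteq> ?I" for Z
    proof
      fix z assume z: "z \<in> Z"
      then have "z \<in> ?\<pi> ` carrier R"
        using additive_subgroup.a_subset[OF ideal.axioms(1)[OF Z]] unfolding surj by (rule subsetD[rotated])
      then obtain r where "r \<in> carrier R" "z = ?\<pi> r" by (rule imageE)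
      with sub z show "z \<in> ?\<pi> ` ?I" by (simp add: subset_iff)
    qed
    ultimately show ?thesis using X Y by (meson)
  qed
  then have "quasi_prime_ideal (R Quot ?A) (?\<pi> ` ?I)"
    unfolding quasi_prime_ideal_def using id ne by simp
  then show ?thesis unfolding qSpec_ring_def natural_map_def by (rule CollectI)
qed

end

end

theory Submission
  imports Defs
begin

text \<open>
  Everything rests on \<open>Cl(Y) = D(\<Im>(Y))\<close>: a closed set \<open>D(N)\<close> contains \<open>Y\<close> iff \<open>(N:M)\<close> lies in
  \<open>(L:M)\<close> for all \<open>L \<in> Y\<close>, that is, iff \<open>(N:M) \<subseteq> (\<Im>(Y):M)\<close>. So the topology only sees \<open>L\<close>
  through \<open>(L:M)\<close>: the specialization order is inclusion of the ideals \<open>(L:M)\<close>, from which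
  the separation axioms can be read off. For finitely generated \<open>M\<close>, a maximal
  element \<open>L\<close> of \<open>qSpec(M)\<close> is a maximal submodule, since \<open>L\<close> lies in a maximal submodule and
  maximal submodules are quasi-prime; then \<open>(L:M)\<close> is a maximal ideal.
\<close>

context Module.module
begin

section \<open>Submodules, their ideals \<open>(N:M)\<close>, and intersections of families\<close>

lemma submodule_zero: "submodule {\<zero>\<^bsub>M\<^esub>} R M"
  by (rule submoduleI) auto

lemma zero_in_submodule: "submodule N R M \<Longrightarrow> \<zero>\<^bsub>M\<^esub> \<in> N"
  using subgroup.one_closed[OF submodule.axioms(1)] by fastforce

lemma colon_mono: "N \<subseteq> N' \<Longrightarrow> colon R M N \<subseteq> colon R M N'"
  by (auto simp: colon_def)

lemma one_in_colon_imp_carrier: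
  assumes "submodule N R M" "\<one> \<in> colon R M N"
  shows "N = carrier M"
  using assms submoduleE(1)[OF assms(1)] by (fastforce simp: colon_def)

lemma qSpec_submodule: "L \<in> qSpec R M \<Longrightarrow> submodule L R M"
  and qSpec_proper: "L \<in> qSpec R M \<Longrightarrow> L \<noteq> carrier M"
  by (auto simp: qSpec_def quasi_prime_submodule_def)

lemma submodule_submodule_Inter:
  assumes "\<And>N. N \<in> Y \<Longrightarrow> submodule N R M"
  shows "submodule (submodule_Inter M Y) R M"
proof -
  \<comment> \<open>Inserting \<open>carrier M\<close> makes the family nonempty, as
    \<open>submodule_Inter_family\<close> demands, and realises the convention for the empty
    family.\<close>
  have "submodule (\<Inter>(insert (carrier M) Y)) R M"
    using assms carrier_is_submodule by (intro submodule_Inter_family) auto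
  then show ?thesis by (simp add: submodule_Inter_def)
qed

text \<open>If rM lies in every member of Y, it lies in their intersection. This is what makes D of
  the intersection the least closed set containing Y.\<close>

lemma subset_colon_submodule_Inter:
  assumes "submodule N R M" "\<And>L. L \<in> Y \<Longrightarrow> colon R M N \<subseteq> colon R M L"
  shows "colon R M N \<subseteq> colon R M (submodule_Inter M Y)"
  using assms by (fastforce simp: colon_def submodule_Inter_def)

subsection \<open>Closures\<close>

lemma closure_of_zariski:
  assumes Y: "Y \<subseteq> qSpec R M"
  shows "(zariski R M) closure_of Y = qD R M (submodule_Inter M Y)"
proof (rule closure_of_unique)
  show "Y \<subseteq> qD R M (submodule_Inter M Y)"
  proof
    fix L assume "L \<in> Y"
    then have "colon R M (submodule_Inter M Y) \<subseteq> colon R M L"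
      by (intro colon_mono) (auto simp: submodule_Inter_def)
    with \<open>L \<in> Y\<close> Y show "L \<in> qD R M (submodule_Inter M Y)" by (auto simp: qD_def)
  qed
  show "closedin (zariski R M) (qD R M (submodule_Inter M Y))"
    using submodule_submodule_Inter[of Y] Y qSpec_submodule unfolding closedin_zariski by blast
next
  fix T assume "Y \<subseteq> T" "closedin (zariski R M) T"
  then obtain N where N: "submodule N R M" "T = qD R M N" unfolding closedin_zariski by blast
  have "colon R M N \<subseteq> colon R M (submodule_Inter M Y)"
    using \<open>Y \<subseteq> T\<close> N by (intro subset_colon_submodule_Inter) (auto simp: qD_def)
  then show "qD R M (submodule_Inter M Y) \<subseteq> T" unfolding N(2) by (auto simp: qD_def)
qed

lemma closure_of_zariski_singleton:
  assumes "L \<in> qSpec R M"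
  shows "(zariski R M) closure_of {L} = qD R M L"
proof -
  have "submodule_Inter M {L} = L"
    using submoduleE(1)[OF qSpec_submodule[OF assms]] by (auto simp: submodule_Inter_def)
  with closure_of_zariski[of "{L}"] assms show ?thesis by simp
qed

text \<open>Every submodule contains zero, so (0:M) lies in every (L:M). A family with zero
  intersection is therefore dense.\<close>

lemma qD_zero: "qD R M {\<zero>\<^bsub>M\<^esub>} = qSpec R M"
  using colon_mono[of "{\<zero>\<^bsub>M\<^esub>}"] zero_in_submodule qSpec_submodule by (auto simp: qD_def)

lemma closure_of_zariski_dense:
  assumes "Y \<subseteq> qSpec R M" "submodule_Inter M Y = {\<zero>\<^bsub>M\<^esub>}"
  shows "(zariski R M) closure_of Y = qSpec R M"
  using closure_of_zariski[OF assms(1)] assms(2) qD_zero by simp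

text \<open>The closure of a connected set is connected, and here it is the whole space. Taking for
  Y the maximal or the prime submodules gives the semiprimitive and the reduced case.\<close>

lemma connected_space_zariski_dense:
  assumes "Y \<subseteq> qSpec R M" "submodule_Inter M Y = {\<zero>\<^bsub>M\<^esub>}" "connectedin (zariski R M) Y"
  shows "connected_space (zariski R M)"
  using connectedin_closure_of[OF assms(3)]
  unfolding closure_of_zariski_dense[OF assms(1,2)] topspace_zariski[symmetric] connectedin_topspace .

lemma submodule_Inter_zero:
  assumes "Y \<subseteq> qSpec R M" "{\<zero>\<^bsub>M\<^esub>} \<in> Y"
  shows "submodule_Inter M Y = {\<zero>\<^bsub>M\<^esub>}"
  using assms zero_in_submodule qSpec_submodule by (fastforce simp: submodule_Inter_def)

subsection \<open>Separation axioms\<close>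

lemma closedin_zariski_singleton:
  assumes "L \<in> qSpec R M"
  shows "closedin (zariski R M) {L} \<longleftrightarrow> qD R M L = {L}"
  using closure_of_eq[of "zariski R M" "{L}"] unfolding closure_of_zariski_singleton[OF assms]
  by (rule sym)

text \<open>D(L) can contain a point N other than L in two ways: (N:M) is strictly larger than
  (L:M), or the two ideals agree although N and L differ. The two conditions exclude one case
  each.\<close>

lemma closedin_zariski_singleton_iff:
  assumes L: "L \<in> qSpec R M"
  shows "closedin (zariski R M) {L} \<longleftrightarrow>
    is_maximal_in (colon R M L) (colon_values R M) \<and> qSpec_at R M (colon R M L) = {L}"
proof -
  have "is_maximal_in (colon R M L) (colon_values R M) \<longleftrightarrow>
      (\<forall>N \<in> qSpec R M. colon R M L \<subseteq> colon R M N \<longrightarrow> colon R M N = colon R M L)"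
    using L unfolding is_maximal_in_def colon_values_def by blast
  moreover have "qSpec_at R M (colon R M L) = {L} \<longleftrightarrow>
      (\<forall>N \<in> qSpec R M. colon R M N = colon R M L \<longrightarrow> N = L)"
    using L unfolding qSpec_at_def by blast
  moreover have "qD R M L = {L} \<longleftrightarrow>
      (\<forall>N \<in> qSpec R M. colon R M L \<subseteq> colon R M N \<longrightarrow> N = L)"
    using L unfolding qD_def by blast
  ultimately show ?thesis
    unfolding closedin_zariski_singleton[OF L] by (metis order_refl)
qed

lemma closedin_zariski_singleton_imp_maximal:
  assumes L: "L \<in> qSpec R M" and "closedin (zariski R M) {L}"
  shows "is_maximal_in L (qSpec R M)"
proof -
  have "N = L" if "N \<in> qSpec R M" "L \<subseteq> N" for N
    using assms colon_mono[OF that(2)] that(1) unfolding closedin_zariski_singleton[OF L] qD_def by blast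
  with L show ?thesis by (simp add: is_maximal_in_def)
qed

text \<open>Membership in a closed set depends only on (L:M), so points with equal ideals cannot be
  separated. If the ideals differ, antisymmetry of inclusion shows that D(L) misses N or D(N) misses
  L.\<close>

lemma t0_space_zariski: "t0_space (zariski R M) \<longleftrightarrow> inj_on (colon R M) (qSpec R M)"
proof
  assume t0: "t0_space (zariski R M)"
  show "inj_on (colon R M) (qSpec R M)"
  proof (rule inj_onI, rule ccontr)
    fix L N assume LN: "L \<in> qSpec R M" "N \<in> qSpec R M" "colon R M L = colon R M N" "L \<noteq> N"
    then obtain C where "closedin (zariski R M) C" "L \<notin> C \<longleftrightarrow> N \<in> C"
      using t0 unfolding t0_space topspace_zariski by blast
    with LN show False by (auto simp: closedin_zariski qD_def)
  qed
next
  assume inj: "inj_on (colon R M) (qSpec R M)"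
  show "t0_space (zariski R M)"
    unfolding t0_space topspace_zariski
  proof (intro ballI impI)
    fix L N assume LN: "L \<in> qSpec R M" "N \<in> qSpec R M" "L \<noteq> N"
    have closed: "closedin (zariski R M) (qD R M L)" "closedin (zariski R M) (qD R M N)"
      using LN qSpec_submodule unfolding closedin_zariski by blast+
    have "\<not> (N \<in> qD R M L \<and> L \<in> qD R M N)"
      using inj LN by (auto simp: qD_def inj_on_def)
    moreover have "L \<in> qD R M L" "N \<in> qD R M N" using LN by (auto simp: qD_def)
    ultimately show "\<exists>C. closedin (zariski R M) C \<and> (L \<notin> C \<longleftrightarrow> N \<in> C)"
      using closed by blast
  qed
qed

text \<open>T1 means that all singletons are closed. The fibre conditions of
  \<open>closedin_zariski_singleton_iff\<close>, taken over all L, amount to injectivity of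
  \<open>colon R M\<close>, which is T0.\<close>

lemma t1_space_zariski:
  "t1_space (zariski R M) \<longleftrightarrow>
    t0_space (zariski R M) \<and>
    (\<forall>L \<in> qSpec R M. is_maximal_in (colon R M L) (colon_values R M))"
proof -
  have "(\<forall>L \<in> qSpec R M. qSpec_at R M (colon R M L) = {L}) \<longleftrightarrow> inj_on (colon R M) (qSpec R M)"
    by (auto simp: qSpec_at_def inj_on_def)
  then show ?thesis
    by (simp add: t1_space_closedin_singleton topspace_zariski t0_space_zariski
        closedin_zariski_singleton_iff ball_conj_distrib conj_commute)
qed

text \<open>\<open>Ann(M) \<subseteq> (L:M)\<close>, so the coset of \<open>r\<close> determines whether \<open>r \<in> (L:M)\<close>.\<close>

lemma colon_eq_vimage_natural_map:
  assumes L: "L \<in> qSpec R M"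
  shows "colon R M L = {r \<in> carrier R. Ann R M +> r \<in> natural_map R M L}"
proof (intro equalityI subsetI)
  fix r assume "r \<in> colon R M L"
  then show "r \<in> {r \<in> carrier R. Ann R M +> r \<in> natural_map R M L}"
    by (auto simp: natural_map_def colon_def)
next
  fix r assume "r \<in> {r \<in> carrier R. Ann R M +> r \<in> natural_map R M L}"
  then obtain s where r: "r \<in> carrier R" and s: "s \<in> colon R M L" "Ann R M +> r = Ann R M +> s"
    by (auto simp: natural_map_def)
  have A: "ideal (Ann R M) R" unfolding Ann_def by (rule ideal_colon[OF submodule_zero])
  \<comment> \<open>As r lies in its own coset, which is also that of s, it is the sum of s and an
    element of Ann(M); both summands lie in (L:M).\<close>
  have "r \<in> Ann R M +> r"
    by (rule abelian_subgroup.a_rcos_self[OF abelian_subgroupI3[OF ideal.axioms(1)[OF A] R.is_abelian_group] r])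
  then obtain a where a: "a \<in> Ann R M" "r = a \<oplus> s"
    unfolding s(2) by (auto simp: a_r_coset_def')
  have "Ann R M \<subseteq> colon R M L"
    unfolding Ann_def using zero_in_submodule[OF qSpec_submodule[OF L]] by (intro colon_mono) simp
  then show "r \<in> colon R M L"
    using a s additive_subgroup.a_closed[OF ideal.axioms(1)[OF ideal_colon[OF qSpec_submodule[OF L]]]]
    by blast
qed

text \<open>(L:M) and its image modulo Ann(M) determine each other, so quasi-prime-embedding becomes
  the criterion already found for T0.\<close>

lemma quasi_prime_embedding_iff_inj_on_colon:
  "quasi_prime_embedding R M \<longleftrightarrow> inj_on (colon R M) (qSpec R M)"
proof -
  have "natural_map R M L = natural_map R M N \<longleftrightarrow> colon R M L = colon R M N"
    if "L \<in> qSpec R M" "N \<in> qSpec R M" for L N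
  proof
    assume eq: "natural_map R M L = natural_map R M N"
    show "colon R M L = colon R M N"
      unfolding colon_eq_vimage_natural_map[OF that(1)] colon_eq_vimage_natural_map[OF that(2)] eq ..
  next
    assume "colon R M L = colon R M N"
    then show "natural_map R M L = natural_map R M N" by (simp add: natural_map_def)
  qed
  then show ?thesis unfolding quasi_prime_embedding_def inj_on_def by metis
qed

subsection \<open>Prime and maximal submodules\<close>

lemma Spec_subset_qSpec: "Spec R M \<subseteq> qSpec R M"
proof
  fix P assume "P \<in> Spec R M"
  then have P: "submodule P R M" "P \<noteq> carrier M"
    and prime: "\<And>r m. \<lbrakk>r \<in> carrier R; m \<in> carrier M; r \<odot>\<^bsub>M\<^esub> m \<in> P\<rbrakk> \<Longrightarrow> r \<in> colon R M P \<or> m \<in> P"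
    by (auto simp: Spec_def prime_submodule_def)
  have "A \<subseteq> colon R M P \<or> B \<subseteq> colon R M P"
    if A: "ideal A R" and B: "ideal B R" and AB: "A \<inter> B \<subseteq> colon R M P" for A B
  proof (rule ccontr)
    assume "\<not> ?thesis"
    then obtain a b where a: "a \<in> A" "a \<notin> colon R M P" and b: "b \<in> B" "b \<notin> colon R M P" by blast
    have car: "a \<in> carrier R" "b \<in> carrier R"
      using a b ideal.Icarr[OF A] ideal.Icarr[OF B] by auto
    \<comment> \<open>The product lies in both ideals, hence in their intersection. Primeness is
      then applied to a and the element bm: as a is outside (P:M), bm must lie in P for every m,
      which puts b in (P:M).\<close>
    have ab: "a \<otimes> b \<in> colon R M P"
      using AB ideal.I_r_closed[OF A a(1) car(2)] ideal.I_l_closed[OF B b(1) car(1)] by blast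
    have "b \<odot>\<^bsub>M\<^esub> m \<in> P" if m: "m \<in> carrier M" for m
      using prime[of a "b \<odot>\<^bsub>M\<^esub> m"] ab a(2) car m by (auto simp: colon_def smult_assoc1)
    with b(2) car show False by (auto simp: colon_def)
  qed
  moreover have "colon R M P \<noteq> carrier R"
    using one_in_colon_imp_carrier[OF P(1)] P(2) by auto
  ultimately show "P \<in> qSpec R M"
    using P ideal_colon[OF P(1)]
    by (simp add: qSpec_def quasi_prime_submodule_def quasi_prime_ideal_def)
qed

lemma Max_submodulesD:
  assumes "N \<in> Max_submodules R M"
  shows "submodule N R M" "N \<noteq> carrier M"
    and "\<And>K. \<lbrakk>submodule K R M; N \<subseteq> K; m \<in> K; m \<notin> N\<rbrakk> \<Longrightarrow> K = carrier M"
  using assms by (auto simp: Max_submodules_def is_maximal_in_def)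

lemma Max_submodules_subset_Spec: "Max_submodules R M \<subseteq> Spec R M"
proof
  fix N assume N: "N \<in> Max_submodules R M"
  note E = submoduleE[OF Max_submodulesD(1)[OF N]]
  have "r \<in> colon R M N \<or> m \<in> N"
    if r: "r \<in> carrier R" and m: "m \<in> carrier M" "r \<odot>\<^bsub>M\<^esub> m \<in> N" for r m
  proof (cases "m \<in> N")
    case False
    \<comment> \<open>This submodule contains N and also m, which is outside N. By maximality it is
      all of M, that is, rM lies in N.\<close>
    let ?K = "{x \<in> carrier M. r \<odot>\<^bsub>M\<^esub> x \<in> N}"
    have "submodule ?K R M"
    proof (rule submoduleI)
      fix a x assume a: "a \<in> carrier R" and x: "x \<in> ?K"
      have "r \<odot>\<^bsub>M\<^esub> (a \<odot>\<^bsub>M\<^esub> x) = a \<odot>\<^bsub>M\<^esub> (r \<odot>\<^bsub>M\<^esub> x)"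
        using a x r by (simp add: R.m_comm flip: smult_assoc1)
      then show "a \<odot>\<^bsub>M\<^esub> x \<in> ?K" using a x E(4) by auto
    qed (use r E(3,5) zero_in_submodule[OF Max_submodulesD(1)[OF N]] in
          \<open>auto simp: smult_r_distr smult_r_minus\<close>)
    moreover have "N \<subseteq> ?K" using r E(1,4) by auto
    ultimately have "?K = carrier M"
      using Max_submodulesD(3)[OF N, of ?K m] m False by blast
    with r show ?thesis by (auto simp: colon_def)
  qed simp
  then show "N \<in> Spec R M"
    using Max_submodulesD(1,2)[OF N] by (simp add: Spec_def prime_submodule_def)
qed

text \<open>N + Ry is a submodule strictly larger than N, hence all of M.\<close>

lemma Max_submodules_span:
  assumes N: "N \<in> Max_submodules R M" and y: "y \<in> carrier M" "y \<notin> N" and m: "m \<in> carrier M"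
  obtains n s where "n \<in> N" "s \<in> carrier R" "m = n \<oplus>\<^bsub>M\<^esub> s \<odot>\<^bsub>M\<^esub> y"
proof -
  note E = submoduleE[OF Max_submodulesD(1)[OF N]]
  note zN = zero_in_submodule[OF Max_submodulesD(1)[OF N]]
  let ?K = "{n \<oplus>\<^bsub>M\<^esub> s \<odot>\<^bsub>M\<^esub> y | n s. n \<in> N \<and> s \<in> carrier R}"
  have KI: "x \<in> ?K" if "n \<in> N" "s \<in> carrier R" "x = n \<oplus>\<^bsub>M\<^esub> s \<odot>\<^bsub>M\<^esub> y" for x n s
    using that by blast
  have NK: "N \<subseteq> ?K"
  proof
    fix n assume "n \<in> N"
    then show "n \<in> ?K" using E(1) y by (intro KI[of n \<zero>]) auto
  qed
  have "submodule ?K R M"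
  proof (rule submoduleI)
    show "?K \<subseteq> carrier M" using E(1) y by auto
    show "\<zero>\<^bsub>M\<^esub> \<in> ?K" using NK zN by blast
  next
    fix a assume "a \<in> ?K"
    then obtain n s where a: "n \<in> N" "s \<in> carrier R" "a = n \<oplus>\<^bsub>M\<^esub> s \<odot>\<^bsub>M\<^esub> y" by blast
    moreover have "n \<in> carrier M" using a E(1) by blast
    ultimately show "\<ominus>\<^bsub>M\<^esub> a \<in> ?K"
      using E(3) y by (intro KI[of "\<ominus>\<^bsub>M\<^esub> n" "\<ominus> s"]) (auto simp: smult_l_minus M.minus_add)
  next
    fix a b assume "a \<in> ?K" "b \<in> ?K"
    then obtain n s n' s' where a: "n \<in> N" "s \<in> carrier R" "a = n \<oplus>\<^bsub>M\<^esub> s \<odot>\<^bsub>M\<^esub> y"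
      and b: "n' \<in> N" "s' \<in> carrier R" "b = n' \<oplus>\<^bsub>M\<^esub> s' \<odot>\<^bsub>M\<^esub> y" by blast
    moreover have "n \<in> carrier M" "n' \<in> carrier M" using a b E(1) by blast+
    ultimately show "a \<oplus>\<^bsub>M\<^esub> b \<in> ?K"
      using E(5) y by (intro KI[of "n \<oplus>\<^bsub>M\<^esub> n'" "s \<oplus> s'"]) (auto simp: smult_l_distr M.a_ac)
  next
    fix r a assume r: "r \<in> carrier R" and "a \<in> ?K"
    then obtain n s where a: "n \<in> N" "s \<in> carrier R" "a = n \<oplus>\<^bsub>M\<^esub> s \<odot>\<^bsub>M\<^esub> y" by blast
    moreover have "n \<in> carrier M" using a E(1) by blast
    ultimately show "r \<odot>\<^bsub>M\<^esub> a \<in> ?K"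
      using r E(4) y by (intro KI[of "r \<odot>\<^bsub>M\<^esub> n" "r \<otimes> s"]) (auto simp: smult_r_distr smult_assoc1)
  qed
  moreover have "y \<in> ?K" using zN y by (intro KI[of "\<zero>\<^bsub>M\<^esub>" \<one>]) auto
  ultimately have "?K = carrier M" using Max_submodulesD(3)[OF N, of ?K y] NK y by blast
  with m that show thesis by blast
qed

text \<open>(P:M) is a maximal ideal. An r in J outside (P:M) moves some m outside P to rm, still
  outside P since P is prime. Then m = n + srm with n in P, so (1 - sr)m lies in P. Primeness puts 1
  - sr in (P:M), hence in J, and J would contain 1.\<close>

lemma colon_Max_submodule_maximal:
  assumes P: "P \<in> Max_submodules R M" and J: "ideal J R" "\<one> \<notin> J" "colon R M P \<subseteq> J"
  shows "J = colon R M P"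
proof (rule ccontr)
  assume "J \<noteq> colon R M P"
  with J(3) obtain r where r: "r \<in> J" "r \<notin> colon R M P" by blast
  have rc: "r \<in> carrier R" using ideal.Icarr[OF J(1) r(1)] .
  note sub = Max_submodulesD(1)[OF P]
  have prime: "s \<in> colon R M P \<or> x \<in> P" if "s \<in> carrier R" "x \<in> carrier M" "s \<odot>\<^bsub>M\<^esub> x \<in> P" for s x
    using P Max_submodules_subset_Spec that by (auto simp: Spec_def prime_submodule_def)
  obtain m where m: "m \<in> carrier M" "m \<notin> P"
    using Max_submodulesD(2)[OF P] submoduleE(1)[OF sub] by blast
  have "r \<odot>\<^bsub>M\<^esub> m \<notin> P" using prime[OF rc m(1)] r m by blast
  then obtain n s where n: "n \<in> P" and s: "s \<in> carrier R" and eq: "m = n \<oplus>\<^bsub>M\<^esub> s \<odot>\<^bsub>M\<^esub> (r \<odot>\<^bsub>M\<^esub> m)"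
    using Max_submodules_span[OF P, of "r \<odot>\<^bsub>M\<^esub> m" m] rc m by blast
  let ?t = "\<one> \<oplus> \<ominus> (s \<otimes> r)"
  have sr: "s \<otimes> r \<in> J" using ideal.I_l_closed[OF J(1) r(1) s] .
  have nc: "n \<in> carrier M" using n submoduleE(1)[OF sub] by blast
  have "?t \<odot>\<^bsub>M\<^esub> m = m \<oplus>\<^bsub>M\<^esub> \<ominus>\<^bsub>M\<^esub> (s \<odot>\<^bsub>M\<^esub> (r \<odot>\<^bsub>M\<^esub> m))"
    using rc s m by (simp add: smult_l_distr smult_l_minus smult_assoc1)
  also have "\<dots> = (n \<oplus>\<^bsub>M\<^esub> s \<odot>\<^bsub>M\<^esub> (r \<odot>\<^bsub>M\<^esub> m)) \<oplus>\<^bsub>M\<^esub> \<ominus>\<^bsub>M\<^esub> (s \<odot>\<^bsub>M\<^esub> (r \<odot>\<^bsub>M\<^esub> m))"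
    using eq by (rule arg_cong)
  also have "\<dots> = n" using nc rc s m by (simp add: M.a_assoc M.r_neg)
  finally have "?t \<odot>\<^bsub>M\<^esub> m \<in> P" using n by simp
  then have "?t \<in> J" using prime[of ?t m] m rc s J(3) by auto
  \<comment> \<open>Both 1 - sr and sr lie in J, and they add up to 1.\<close>
  then have "?t \<oplus> s \<otimes> r \<in> J"
    using sr additive_subgroup.a_closed[OF ideal.axioms(1)[OF J(1)]] by blast
  moreover have "?t \<oplus> s \<otimes> r = \<one>" using rc s by (simp add: R.a_assoc R.l_neg)
  ultimately show False using J(2) by simp
qed

section \<open>Maximal submodules of finitely generated modules\<close>

lemma submodule_Union_chain:
  assumes sub: "\<And>N. N \<in> C \<Longrightarrow> submodule N R M" and ne: "C \<noteq> {}"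
    and chain: "\<And>N K. \<lbrakk>N \<in> C; K \<in> C\<rbrakk> \<Longrightarrow> N \<subseteq> K \<or> K \<subseteq> N"
  shows "submodule (\<Union>C) R M"
proof (rule submoduleI)
  show "\<Union>C \<subseteq> carrier M" using sub submoduleE(1) by blast
  show "\<zero>\<^bsub>M\<^esub> \<in> \<Union>C" using sub ne zero_in_submodule by blast
  fix a b assume "a \<in> \<Union>C" "b \<in> \<Union>C"
  then obtain N where "N \<in> C" "a \<in> N" "b \<in> N" using chain by blast
  then show "a \<oplus>\<^bsub>M\<^esub> b \<in> \<Union>C" using sub submoduleE(5) by blast
qed (use sub submoduleE(3,4) in blast)+

text \<open>Zorn's lemma applied to the proper submodules containing L. Finite generation keeps the
  union of a chain proper.\<close>

lemma finitely_generated_imp_Max_submodule: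
  assumes fg: "finitely_generated_module R M" and L: "submodule L R M" "L \<noteq> carrier M"
  obtains P where "P \<in> Max_submodules R M" "L \<subseteq> P"
proof -
  obtain S where S: "finite S" "S \<subseteq> carrier M" "\<Inter>{N. submodule N R M \<and> S \<subseteq> N} = carrier M"
    using fg by (auto simp: finitely_generated_module_def)
  \<comment> \<open>Stated through the finite generating set S, properness passes to unions of
    chains: if the union contained S, a single member of the chain would.\<close>
  have proper: "K \<noteq> carrier M \<longleftrightarrow> \<not> S \<subseteq> K" if "submodule K R M" for K
    using S that submoduleE(1)[OF that] by blast
  let ?A = "{K. submodule K R M \<and> \<not> S \<subseteq> K \<and> L \<subseteq> K}"
  have "\<exists>P\<in>?A. \<forall>X\<in>?A. P \<subseteq> X \<longrightarrow> X = P"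
  proof (rule subset_Zorn_nonempty)
    show "?A \<noteq> {}" using L proper by blast
  next
    fix C assume ne: "C \<noteq> {}" and ch: "subset.chain ?A C"
    have C: "C \<subseteq> ?A" and lin: "\<And>N K. \<lbrakk>N \<in> C; K \<in> C\<rbrakk> \<Longrightarrow> N \<subseteq> K \<or> K \<subseteq> N"
      using ch by (auto simp: subset_chain_def)
    have "submodule (\<Union>C) R M" using C lin ne by (intro submodule_Union_chain) auto
    moreover have "\<not> S \<subseteq> \<Union>C"
    proof
      assume "S \<subseteq> \<Union>C"
      then obtain B where "B \<in> C" "S \<subseteq> B" by (rule finite_subset_Union_chain[OF S(1) _ ne ch])
      with C show False by blast
    qed
    moreover have "L \<subseteq> \<Union>C" using C ne by blast
    ultimately show "\<Union>C \<in> ?A" by blast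
  qed
  then obtain P where P: "P \<in> ?A" "\<forall>X\<in>?A. P \<subseteq> X \<longrightarrow> X = P" ..
  then have sub: "submodule P R M" "\<not> S \<subseteq> P" "L \<subseteq> P" by simp_all
  \<comment> \<open>Any K above P contains L as well, so maximality of P in \<open>?A\<close> is
    maximality among all proper submodules.\<close>
  have "K = P" if "submodule K R M" "K \<noteq> carrier M" "P \<subseteq> K" for K
    using P(2) that sub(3) proper by simp
  moreover have "P \<noteq> carrier M" using sub(2) proper[OF sub(1)] by simp
  ultimately have "P \<in> Max_submodules R M"
    using sub(1) unfolding Max_submodules_def is_maximal_in_def by blast
  then show thesis using sub(3) by (rule that)
qed

text \<open>This is the only place where the T1 criterion needs finite generation: it turns
  maximality of the submodule into maximality of its ideal.\<close>

lemma finitely_generated_maximal_imp_maximal_colon: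
  assumes fg: "finitely_generated_module R M" and L: "is_maximal_in L (qSpec R M)"
  shows "is_maximal_in (colon R M L) (colon_values R M)"
proof -
  have Lq: "L \<in> qSpec R M" using L by (simp add: is_maximal_in_def)
  obtain P where P: "P \<in> Max_submodules R M" "L \<subseteq> P"
    using finitely_generated_imp_Max_submodule[OF fg qSpec_submodule[OF Lq] qSpec_proper[OF Lq]] .
  \<comment> \<open>P is itself quasi-prime, so maximality of L in \<open>qSpec R M\<close> forces P
    = L.\<close>
  then have LM: "L \<in> Max_submodules R M"
    using L Max_submodules_subset_Spec Spec_subset_qSpec by (auto simp: is_maximal_in_def)
  have "colon R M N = colon R M L" if N: "N \<in> qSpec R M" "colon R M L \<subseteq> colon R M N" for N
  proof (rule colon_Max_submodule_maximal[OF LM ideal_colon[OF qSpec_submodule[OF N(1)]] _ N(2)])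
    show "\<one> \<notin> colon R M N"
      using one_in_colon_imp_carrier qSpec_submodule qSpec_proper N(1) by blast
  qed
  with Lq show ?thesis by (auto simp: is_maximal_in_def colon_values_def)
qed

lemma t1_space_zariski_imp_maximal:
  assumes "t1_space (zariski R M)" "L \<in> qSpec R M"
  shows "is_maximal_in L (qSpec R M)"
  using assms closedin_zariski_singleton_imp_maximal
  by (simp add: t1_space_closedin_singleton topspace_zariski)

text \<open>The closure of the point 0 is D(0), the whole space, so this point is closed only if
  there is no other. Conversely, a one-point space is T1.\<close>

lemma t1_space_zariski_zero:
  assumes z: "{\<zero>\<^bsub>M\<^esub>} \<in> qSpec R M"
  shows "t1_space (zariski R M) \<longleftrightarrow> qSpec R M = {{\<zero>\<^bsub>M\<^esub>}}"
proof
  assume "t1_space (zariski R M)"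
  then have "closedin (zariski R M) {{\<zero>\<^bsub>M\<^esub>}}"
    using z by (simp add: t1_space_closedin_singleton topspace_zariski)
  then show "qSpec R M = {{\<zero>\<^bsub>M\<^esub>}}"
    using closedin_zariski_singleton[OF z] qD_zero by simp
next
  assume "qSpec R M = {{\<zero>\<^bsub>M\<^esub>}}"
  then show "t1_space (zariski R M)" by (simp add: t1_space_def topspace_zariski)
qed

end

theorem proposition3p4:
  fixes R :: "('r, 'k) ring_scheme" and M :: "('r, 'm, 's) module_scheme"
  assumes "Module.module R M" and "\<one>\<^bsub>R\<^esub> \<noteq> \<zero>\<^bsub>R\<^esub>"
  shows
    "((\<forall>Y. Y \<subseteq> qSpec R M \<longrightarrow>
         qD R M (submodule_Inter M Y) = (zariski R M) closure_of Y) \<and>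
      (\<forall>I L. quasi_prime_ideal R I \<and> L \<in> qSpec_at R M I \<longrightarrow>
         (zariski R M) closure_of {L} = qD R M L))
   \<and> ((semiprimitive_module R M \<and> Max_submodules R M \<noteq> {} \<and>
        connectedin (zariski R M) (Max_submodules R M) \<longrightarrow>
          connected_space (zariski R M)) \<and>
      (reduced_module R M \<and> Spec R M \<noteq> {} \<and>
        connectedin (zariski R M) (Spec R M) \<longrightarrow>
          connected_space (zariski R M)))
   \<and> (\<forall>Y. Y \<subseteq> qSpec R M \<and> {\<zero>\<^bsub>M\<^esub>} \<in> Y \<longrightarrow>
         (zariski R M) closure_of Y = qSpec R M)
   \<and> (\<forall>I L. quasi_prime_ideal R I \<and> L \<in> qSpec_at R M I \<longrightarrow>
         (closedin (zariski R M) {L} \<longleftrightarrow>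
            is_maximal_in I (colon_values R M) \<and> qSpec_at R M I = {L}))
   \<and> (\<forall>I L. quasi_prime_ideal R I \<and> L \<in> qSpec_at R M I \<longrightarrow>
         closedin (zariski R M) {L} \<longrightarrow>
            is_maximal_in L (qSpec R M) \<and> qSpec_at R M I = {L})
   \<and> (quasi_prime_embedding R M \<longleftrightarrow> t0_space (zariski R M))
   \<and> (t1_space (zariski R M) \<longleftrightarrow>
         t0_space (zariski R M) \<and>
         (\<forall>L \<in> qSpec R M. is_maximal_in (colon R M L) (colon_values R M)))
   \<and> ((t1_space (zariski R M) \<longrightarrow>
         t0_space (zariski R M) \<and> (\<forall>L \<in> qSpec R M. is_maximal_in L (qSpec R M))) \<and>
      (finitely_generated_module R M \<longrightarrow>
         t0_space (zariski R M) \<and> (\<forall>L \<in> qSpec R M. is_maximal_in L (qSpec R M)) \<longrightarrow>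
           t1_space (zariski R M)))
   \<and> ({\<zero>\<^bsub>M\<^esub>} \<in> qSpec R M \<longrightarrow>
         (t1_space (zariski R M) \<longleftrightarrow> qSpec R M = {{\<zero>\<^bsub>M\<^esub>}}))"
proof -
  interpret Module.module R M by fact
  note sub = Spec_subset_qSpec order_trans[OF Max_submodules_subset_Spec Spec_subset_qSpec]
  show ?thesis
  proof (intro conjI allI impI)
    fix I L assume "quasi_prime_ideal R I \<and> L \<in> qSpec_at R M I"
    \<comment> \<open>Membership in \<open>qSpec_at R M I\<close> identifies I with (L:M), which
      reduces the claims about I to the lemmas on \<open>colon R M L\<close>.\<close>
    then have L: "L \<in> qSpec R M" "I = colon R M L" by (auto simp: qSpec_at_def)
    show "(zariski R M) closure_of {L} = qD R M L"
      using closure_of_zariski_singleton L by blast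
    show "closedin (zariski R M) {L} \<longleftrightarrow>
        is_maximal_in I (colon_values R M) \<and> qSpec_at R M I = {L}"
      using closedin_zariski_singleton_iff L by blast
    assume "closedin (zariski R M) {L}"
    then show "is_maximal_in L (qSpec R M)" "qSpec_at R M I = {L}"
      using closedin_zariski_singleton_imp_maximal closedin_zariski_singleton_iff L by blast+
  next
    assume "semiprimitive_module R M \<and> Max_submodules R M \<noteq> {} \<and>
      connectedin (zariski R M) (Max_submodules R M)"
    then show "connected_space (zariski R M)"
      using connected_space_zariski_dense[of "Max_submodules R M"] sub
      by (simp add: semiprimitive_module_def)
  next
    assume "reduced_module R M \<and> Spec R M \<noteq> {} \<and> connectedin (zariski R M) (Spec R M)"
    then show "connected_space (zariski R M)"
      using connected_space_zariski_dense[of "Spec R M"] sub by (simp add: reduced_module_def)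
  next
    fix Y assume "Y \<subseteq> qSpec R M \<and> {\<zero>\<^bsub>M\<^esub>} \<in> Y"
    then show "(zariski R M) closure_of Y = qSpec R M"
      by (simp add: closure_of_zariski_dense submodule_Inter_zero)
  next
    fix Y assume "Y \<subseteq> qSpec R M"
    then show "qD R M (submodule_Inter M Y) = (zariski R M) closure_of Y"
      by (simp add: closure_of_zariski)
  next
    show "quasi_prime_embedding R M \<longleftrightarrow> t0_space (zariski R M)"
      unfolding quasi_prime_embedding_iff_inj_on_colon t0_space_zariski ..
  next
    assume "finitely_generated_module R M"
      and "t0_space (zariski R M) \<and> (\<forall>L \<in> qSpec R M. is_maximal_in L (qSpec R M))"
    then show "t1_space (zariski R M)"
      by (simp add: t1_space_zariski finitely_generated_maximal_imp_maximal_colon)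
  next
    assume "t1_space (zariski R M)"
    then show "t0_space (zariski R M)" "\<forall>L \<in> qSpec R M. is_maximal_in L (qSpec R M)"
      by (simp_all add: t1_imp_t0_space t1_space_zariski_imp_maximal)
  next
    assume "{\<zero>\<^bsub>M\<^esub>} \<in> qSpec R M"
    then show "t1_space (zariski R M) \<longleftrightarrow> qSpec R M = {{\<zero>\<^bsub>M\<^esub>}}"
      by (rule t1_space_zariski_zero)
  \<comment> \<open>The goal still open is the characterisation of T1 by T0 and maximal ideals
    (L:M).\<close>
  qed (rule t1_space_zariski)
qed

end
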